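(* Let $M$ be an odd-dimensional smooth manifold with an almost paracontact structure $(\varphi,\xi,\eta)$, and let $\Phi=\begin{pmatrix}\varphi & 0\\ 0 & -\varphi^*\end{pmatrix}$ be the endomorphism of $TM\oplus T^*M$ of the induced generalized almost paracontact structure. Let $\beta$ be a bivector field on $M$ and let $\Phi_\beta:=e^{\beta}\Phi e^{-\beta}$, where $e^{\beta}=\begin{pmatrix}I & \beta\\ 0 & I\end{pmatrix}$. If $\eta(\beta(\alpha))\cdot\xi=\alpha(\xi)\cdot\beta(\eta)$ for every $\alpha\in\Gamma(T^*M)$, then $(\Phi_\beta,\xi,\eta)$ is a generalized almost paracontact structure on $M$.
   Context: An almost paracontact structure $(\varphi,\xi,\eta)$ on an odd-dimensional manifold $M$ consists of a $(1,1)$-tensor field $\varphi$, a vector field $\xi$ and a $1$-form $\eta$ such that $\varphi^2=I-\eta\otimes\xi$ (i.e. $\varphi^2X=X-\eta(X)\xi$) and $\eta(\xi)=1$. The paper takes these conditions to include $\varphi\xi=0$ and $\eta\circ\varphi=0$. Sections of $TM\oplus T^*M$ are written $X+\alpha$ with $X$ a vector field and $\alpha$ a $1$-form; block matrices act as on columns $(X,\alpha)^T$. For an endomorphism $A$ of $TM$, its dual $A^*$ is $(A^*\alpha)(X)=\alpha(AX)$. A bivector field $\beta$ (skew-symmetric) is viewed as the map $\beta:\Gamma(T^*M)\to\Gamma(TM)$, $\gamma(\beta(\alpha))=\beta(\alpha,\gamma)$ (the opposite sign convention gives an equivalent statement). The neutral metric on $TM\oplus T^*M$ is $g_0(X+\alpha,Y+\gamma)=\frac12(\alpha(Y)+\gamma(X))$.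 A triple $(\Psi,\xi,\eta)$, with $\Psi$ an endomorphism of $TM\oplus T^*M$, $\xi$ a vector field and $\eta$ a $1$-form on $M$, is a generalized almost paracontact structure if: (1) $g_0(\Psi(X+\alpha),Y+\gamma)=-g_0(X+\alpha,\Psi(Y+\gamma))$ for all $X+\alpha,Y+\gamma\in\Gamma(TM\oplus T^*M)$; (2) $\Psi^2=\begin{pmatrix}I-\eta\otimes\xi & 0\\ 0 & (I-\eta\otimes\xi)^*\end{pmatrix}$; (3) $\Psi\begin{pmatrix}\eta\otimes\xi & 0\\ 0 & (\eta\otimes\xi)^*\end{pmatrix}=0$; (4) $\|\xi+\eta\|_{g_0}=1$, i.e. $g_0(\xi+\eta,\xi+\eta)=1$. Here $(\eta\otimes\xi)X=\eta(X)\xi$. *)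

theory Defs
  imports "HOL-Analysis.Analysis" "HOL-Library.Function_Algebras"
begin

text \<open>
  A manifold is a Hausdorff, second countable type \<open>'a\<close> together with a smooth atlas with values in
  \<open>real ^ 'n\<close>. Vector fields are the derivations of the algebra of smooth functions, and tensor
  fields are maps that are (multi)linear over that algebra. All operations on function spaces
  (\<open>+\<close>, \<open>-\<close>, \<open>*\<close>, \<open>0\<close>, \<open>1\<close>) are the pointwise ones of \<open>Function_Algebras\<close>.
\<close>

section \<open>Smooth manifolds\<close>

text \<open>
  Only meant for open \<open>S\<close>, where differentiability within \<open>S\<close> and the derivative \<open>at x\<close> agree; \<open>C^k\<close> is
  expressed through the directional derivatives \<open>D_v f\<close>.
\<close>

primrec Ck_on :: "nat \<Rightarrow> 'v set \<Rightarrow> ('v::euclidean_space \<Rightarrow> 'w::real_normed_vector) \<Rightarrow> bool" where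
  "Ck_on 0 S f \<longleftrightarrow> continuous_on S f"
| "Ck_on (Suc k) S f \<longleftrightarrow>
     f differentiable_on S \<and> (\<forall>v. Ck_on k S (\<lambda>x. frechet_derivative f (at x) v))"

definition smooth_on :: "'v set \<Rightarrow> ('v::euclidean_space \<Rightarrow> 'w::real_normed_vector) \<Rightarrow> bool" where
  "smooth_on S f \<longleftrightarrow> (\<forall>k. Ck_on k S f)"

type_synonym ('a, 'n) chart = "'a set \<times> ('a \<Rightarrow> real ^ 'n)"

definition smooth_atlas ::
  "('a::{t2_space, second_countable_topology}, 'n::finite) chart set \<Rightarrow> bool" where
  "smooth_atlas A \<longleftrightarrow>
     (\<forall>(U, x)\<in>A. open U \<and> open (x ` U) \<and> homeomorphism U (x ` U) x (inv_into U x)) \<and>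
     (\<Union>(U, x)\<in>A. U) = UNIV \<and>
     (\<forall>(U, x)\<in>A. \<forall>(V, y)\<in>A. smooth_on (x ` (U \<inter> V)) (y \<circ> inv_into U x))"

definition smooth_functions ::
  "('a::{t2_space, second_countable_topology}, 'n::finite) chart set \<Rightarrow> ('a \<Rightarrow> real) set" where
  "smooth_functions A = {f. \<forall>(U, x)\<in>A. smooth_on (x ` U) (f \<circ> inv_into U x)}"

section \<open>Vector fields, one-forms and tensor fields\<close>

type_synonym 'a vfield = "('a \<Rightarrow> real) \<Rightarrow> ('a \<Rightarrow> real)"
type_synonym 'a form = "'a vfield \<Rightarrow> ('a \<Rightarrow> real)"
type_synonym 'a gsection = "'a vfield \<times> 'a form"  \<comment> \<open>\<open>X + \<alpha>\<close> is the pair \<open>(X, \<alpha>)\<close>\<close>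

text \<open>Multiplication of a vector field or of a one-form by a function.\<close>

definition fscale :: "('a \<Rightarrow> real) \<Rightarrow> ('b \<Rightarrow> 'a \<Rightarrow> real) \<Rightarrow> 'b \<Rightarrow> 'a \<Rightarrow> real" (infixr "\<odot>" 75) where
  "f \<odot> T = (\<lambda>u. f * T u)"

text \<open>
  HOL functions are total: to have equality of vector fields and of one-forms mean equality as maps
  on smooth functions and on vector fields, they are required to vanish outside those sets.
\<close>

definition vector_fields ::
  "('a::{t2_space, second_countable_topology}, 'n::finite) chart set \<Rightarrow> 'a vfield set" where
  "vector_fields A = {X.
     (\<forall>f\<in>smooth_functions A. X f \<in> smooth_functions A) \<and>
     (\<forall>f\<in>smooth_functions A. \<forall>g\<in>smooth_functions A. X (f + g) = X f + X g) \<and>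
     (\<forall>c. \<forall>f\<in>smooth_functions A. X (\<lambda>p. c * f p) = (\<lambda>p. c * X f p)) \<and>
     (\<forall>f\<in>smooth_functions A. \<forall>g\<in>smooth_functions A. X (f * g) = f * X g + g * X f) \<and>
     (\<forall>f. f \<notin> smooth_functions A \<longrightarrow> X f = 0)}"

definition one_forms ::
  "('a::{t2_space, second_countable_topology}, 'n::finite) chart set \<Rightarrow> 'a form set" where
  "one_forms A = {\<alpha>.
     (\<forall>X\<in>vector_fields A. \<alpha> X \<in> smooth_functions A) \<and>
     (\<forall>X\<in>vector_fields A. \<forall>Y\<in>vector_fields A. \<alpha> (X + Y) = \<alpha> X + \<alpha> Y) \<and>
     (\<forall>f\<in>smooth_functions A. \<forall>X\<in>vector_fields A. \<alpha> (f \<odot> X) = f * \<alpha> X) \<and>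
     (\<forall>X. X \<notin> vector_fields A \<longrightarrow> \<alpha> X = 0)}"

definition tangent_endomorphism ::
  "('a::{t2_space, second_countable_topology}, 'n::finite) chart set \<Rightarrow>
   ('a vfield \<Rightarrow> 'a vfield) \<Rightarrow> bool" where
  "tangent_endomorphism A \<phi> \<longleftrightarrow>
     (\<forall>X\<in>vector_fields A. \<phi> X \<in> vector_fields A) \<and>
     (\<forall>X\<in>vector_fields A. \<forall>Y\<in>vector_fields A. \<phi> (X + Y) = \<phi> X + \<phi> Y) \<and>
     (\<forall>f\<in>smooth_functions A. \<forall>X\<in>vector_fields A. \<phi> (f \<odot> X) = f \<odot> \<phi> X)"

definition dual ::
  "('a::{t2_space, second_countable_topology}, 'n::finite) chart set \<Rightarrow>
   ('a vfield \<Rightarrow> 'a vfield) \<Rightarrow> 'a form \<Rightarrow> 'a form" where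
  "dual A \<phi> \<alpha> = (\<lambda>X. if X \<in> vector_fields A then \<alpha> (\<phi> X) else 0)"

definition tensor :: "'a form \<Rightarrow> 'a vfield \<Rightarrow> 'a vfield \<Rightarrow> 'a vfield" (infix "\<otimes>\<^sub>t" 70) where
  "(\<eta> \<otimes>\<^sub>t \<xi>) X = \<eta> X \<odot> \<xi>"

definition bivector_field ::
  "('a::{t2_space, second_countable_topology}, 'n::finite) chart set \<Rightarrow>
   ('a form \<Rightarrow> 'a form \<Rightarrow> 'a \<Rightarrow> real) \<Rightarrow> bool" where
  "bivector_field A B \<longleftrightarrow>
     (\<forall>\<alpha>\<in>one_forms A. \<forall>\<gamma>\<in>one_forms A. B \<alpha> \<gamma> \<in> smooth_functions A) \<and>
     (\<forall>\<alpha>\<in>one_forms A. \<forall>\<alpha>'\<in>one_forms A. \<forall>\<gamma>\<in>one_forms A. B (\<alpha> + \<alpha>') \<gamma> = B \<alpha> \<gamma> + B \<alpha>' \<gamma>) \<and>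
     (\<forall>f\<in>smooth_functions A. \<forall>\<alpha>\<in>one_forms A. \<forall>\<gamma>\<in>one_forms A. B (f \<odot> \<alpha>) \<gamma> = f * B \<alpha> \<gamma>) \<and>
     (\<forall>\<alpha>\<in>one_forms A. \<forall>\<gamma>\<in>one_forms A. B \<alpha> \<gamma> = - B \<gamma> \<alpha>)"

text \<open>
  The map from one-forms to vector fields as which a bivector field \<open>B\<close> is viewed. Its values on
  one-forms are determined by \<open>B\<close> (take \<open>\<gamma> = df\<close>), and it exists for every bivector field because
  the tangent spaces are finite-dimensional.
\<close>

definition bivector_map ::
  "('a::{t2_space, second_countable_topology}, 'n::finite) chart set \<Rightarrow>
   ('a form \<Rightarrow> 'a form \<Rightarrow> 'a \<Rightarrow> real) \<Rightarrow> ('a form \<Rightarrow> 'a vfield) \<Rightarrow> bool" where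
  "bivector_map A B \<beta> \<longleftrightarrow>
     (\<forall>\<alpha>\<in>one_forms A. \<beta> \<alpha> \<in> vector_fields A \<and> (\<forall>\<gamma>\<in>one_forms A. \<gamma> (\<beta> \<alpha>) = B \<alpha> \<gamma>))"

section \<open>The generalized tangent bundle\<close>

definition gsections ::
  "('a::{t2_space, second_countable_topology}, 'n::finite) chart set \<Rightarrow> 'a gsection set" where
  "gsections A = vector_fields A \<times> one_forms A"

definition gen_endomorphism ::
  "('a::{t2_space, second_countable_topology}, 'n::finite) chart set \<Rightarrow>
   ('a gsection \<Rightarrow> 'a gsection) \<Rightarrow> bool" where
  "gen_endomorphism A \<Psi> \<longleftrightarrow>
     (\<forall>s\<in>gsections A. \<Psi> s \<in> gsections A) \<and>
     (\<forall>s\<in>gsections A. \<forall>t\<in>gsections A. \<Psi> (s + t) = \<Psi> s + \<Psi> t) \<and>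
     (\<forall>f\<in>smooth_functions A. \<forall>s\<in>gsections A.
        \<Psi> (f \<odot> fst s, f \<odot> snd s) = (f \<odot> fst (\<Psi> s), f \<odot> snd (\<Psi> s)))"

definition block ::
  "('a vfield \<Rightarrow> 'a vfield) \<Rightarrow> ('a form \<Rightarrow> 'a vfield) \<Rightarrow>
   ('a vfield \<Rightarrow> 'a form) \<Rightarrow> ('a form \<Rightarrow> 'a form) \<Rightarrow> 'a gsection \<Rightarrow> 'a gsection" where
  "block a b c d = (\<lambda>(X, \<alpha>). (a X + b \<alpha>, c X + d \<alpha>))"

definition g0 :: "'a gsection \<Rightarrow> 'a gsection \<Rightarrow> 'a \<Rightarrow> real" where
  "g0 = (\<lambda>(X, \<alpha>) (Y, \<gamma>) p. 1 / 2 * (\<alpha> Y p + \<gamma> X p))"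

definition exp_bivector :: "('a form \<Rightarrow> 'a vfield) \<Rightarrow> 'a gsection \<Rightarrow> 'a gsection" where
  "exp_bivector \<beta> = block id \<beta> 0 id"

section \<open>Almost paracontact structures\<close>

definition almost_paracontact ::
  "('a::{t2_space, second_countable_topology}, 'n::finite) chart set \<Rightarrow>
   ('a vfield \<Rightarrow> 'a vfield) \<Rightarrow> 'a vfield \<Rightarrow> 'a form \<Rightarrow> bool" where
  "almost_paracontact A \<phi> \<xi> \<eta> \<longleftrightarrow>
     tangent_endomorphism A \<phi> \<and> \<xi> \<in> vector_fields A \<and> \<eta> \<in> one_forms A \<and>
     (\<forall>X\<in>vector_fields A. \<phi> (\<phi> X) = (id - \<eta> \<otimes>\<^sub>t \<xi>) X) \<and>
     \<eta> \<xi> = 1 \<and> \<phi> \<xi> = 0 \<and> (\<forall>X\<in>vector_fields A. \<eta> (\<phi> X) = 0)"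

definition generalized_almost_paracontact ::
  "('a::{t2_space, second_countable_topology}, 'n::finite) chart set \<Rightarrow>
   ('a gsection \<Rightarrow> 'a gsection) \<Rightarrow> 'a vfield \<Rightarrow> 'a form \<Rightarrow> bool" where
  "generalized_almost_paracontact A \<Psi> \<xi> \<eta> \<longleftrightarrow>
     gen_endomorphism A \<Psi> \<and> \<xi> \<in> vector_fields A \<and> \<eta> \<in> one_forms A \<and>
     (\<forall>s\<in>gsections A. \<forall>t\<in>gsections A. g0 (\<Psi> s) t = - g0 s (\<Psi> t)) \<and>
     (\<forall>s\<in>gsections A. \<Psi> (\<Psi> s) = block (id - \<eta> \<otimes>\<^sub>t \<xi>) 0 0 (dual A (id - \<eta> \<otimes>\<^sub>t \<xi>)) s) \<and>
     (\<forall>s\<in>gsections A. \<Psi> (block (\<eta> \<otimes>\<^sub>t \<xi>) 0 0 (dual A (\<eta> \<otimes>\<^sub>t \<xi>)) s) = 0) \<and>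
     g0 (\<xi>, \<eta>) (\<xi>, \<eta>) = 1"

definition induced_endomorphism ::
  "('a::{t2_space, second_countable_topology}, 'n::finite) chart set \<Rightarrow>
   ('a vfield \<Rightarrow> 'a vfield) \<Rightarrow> 'a gsection \<Rightarrow> 'a gsection" where
  "induced_endomorphism A \<phi> = block \<phi> 0 0 (- dual A \<phi>)"

end

theory Submission
  imports Defs
begin

text \<open>
  Since \<open>e\<^sup>-\<^sup>\<beta>\<close> is the inverse of \<open>e\<^sup>\<beta>\<close>, conjugation gives
  \<open>\<Phi>\<^sub>\<beta> (X, \<alpha>) = (\<phi>X - \<phi>\<beta>\<alpha> - \<beta>\<phi>\<^sup>*\<alpha>, - \<phi>\<^sup>*\<alpha>)\<close> and \<open>\<Phi>\<^sub>\<beta>\<^sup>2 = e\<^sup>\<beta>\<Phi>\<^sup>2e\<^sup>-\<^sup>\<beta>\<close>,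
  so the bivector changes \<open>\<Phi>\<close> only by the term \<open>\<phi>\<beta> + \<beta>\<phi>\<^sup>*\<close> from one-forms to vector fields.

  Skewness for the neutral metric amounts to \<open>B\<close> being skew, because
  \<open>\<gamma>(\<phi>\<beta>\<alpha>) = B(\<alpha>, \<phi>\<^sup>*\<gamma>)\<close> and \<open>\<gamma>(\<beta>\<phi>\<^sup>*\<alpha>) = B(\<phi>\<^sup>*\<alpha>, \<gamma>)\<close>. In the square the two mixed terms
  \<open>\<phi>\<beta>\<phi>\<^sup>*\<close> cancel, and what remains of the corner is \<open>\<beta>(\<phi>\<^sup>*)\<^sup>2\<alpha> - \<phi>\<^sup>2\<beta>\<alpha> = \<eta>(\<beta>\<alpha>)\<xi> - \<alpha>(\<xi>)\<beta>\<eta>\<close>: the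
  hypothesis on \<open>\<beta>\<close> says exactly that this vanishes. The same hypothesis gives
  \<open>\<phi>\<beta>(\<alpha>(\<xi>)\<eta>) = \<phi>(\<eta>(\<beta>\<alpha>)\<xi>) = 0\<close>, which is the third axiom; the fourth is \<open>\<eta>(\<xi>) = 1\<close>.

  These computations use that \<open>\<beta>\<close> is linear over the smooth functions, whereas only \<open>B\<close> is assumed to
  be. Linearity passes from \<open>B\<close> to \<open>\<beta>\<close> because \<open>(\<beta>\<alpha>) f = df(\<beta>\<alpha>) = B(\<alpha>, df)\<close>
  (\<open>bivector_map_linear\<close>). For this, sums and multiples of derivations must again be
  derivations, so the smooth functions have to form an algebra (\<open>function_algebra_smooth\<close>); that is
  the only place where charts enter.
\<close>

section \<open>The algebra of smooth functions\<close>

text \<open>The iterated derivatives of sums and products are known only on \<open>S\<close>, whereas \<open>Ck_on\<close> speaks of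
  functions on the whole space. Openness of \<open>S\<close> makes the derivative at a point of \<open>S\<close> depend only on
  the values in \<open>S\<close>.\<close>

lemma Ck_on_cong:
  assumes "open S" "\<And>x. x \<in> S \<Longrightarrow> f x = g x" "Ck_on k S f"
  shows "Ck_on k S g"
  using assms(2,3)
proof (induction k arbitrary: f g)
  case 0
  then show ?case
    by (metis Ck_on.simps(1) continuous_on_cong)
next
  case (Suc k)
  have deriv: "(g has_derivative frechet_derivative f (at x)) (at x)" if "x \<in> S" for x
  proof -
    have "f differentiable at x"
      using Suc.prems(2) that \<open>open S\<close>
      by (metis Ck_on.simps(2) at_within_open differentiable_on_def)
    then have "(f has_derivative frechet_derivative f (at x)) (at x)"
      by (simp add: frechet_derivative_works)
    then show ?thesis
      by (rule has_derivative_transform_within_open[OF _ \<open>open S\<close> that]) (simp add: Suc.prems(1))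
  qed
  then have "g differentiable_on S"
    by (meson differentiable_def differentiable_at_imp_differentiable_on)
  moreover have "Ck_on k S (\<lambda>x. frechet_derivative g (at x) v)" for v
  proof (rule Suc.IH)
    show "Ck_on k S (\<lambda>x. frechet_derivative f (at x) v)"
      using Suc.prems(2) by simp
    show "frechet_derivative f (at x) v = frechet_derivative g (at x) v" if "x \<in> S" for x
      using frechet_derivative_at[OF deriv[OF that]] by simp
  qed
  ultimately show ?case
    by simp
qed

lemma Ck_on_Suc_imp: "Ck_on (Suc k) S f \<Longrightarrow> Ck_on k S f"
  by (induction k arbitrary: f) (auto intro: differentiable_imp_continuous_on)

lemma Ck_on_const: "Ck_on k S (\<lambda>x. c)"
  by (induction k arbitrary: c) auto

lemma Ck_on_add:
  assumes "open S" "Ck_on k S f" "Ck_on k S g"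
  shows "Ck_on k S (\<lambda>x. f x + g x)"
  using assms(2,3)
proof (induction k arbitrary: f g)
  case 0
  then show ?case by (auto intro: continuous_intros)
next
  case (Suc k)
  have "Ck_on k S (\<lambda>x. frechet_derivative (\<lambda>x. f x + g x) (at x) v)" for v
  proof (rule Ck_on_cong[OF \<open>open S\<close>])
    show "Ck_on k S (\<lambda>x. frechet_derivative f (at x) v + frechet_derivative g (at x) v)"
      using Suc by simp
    show "frechet_derivative f (at x) v + frechet_derivative g (at x) v =
      frechet_derivative (\<lambda>x. f x + g x) (at x) v" if "x \<in> S" for x
    proof -
      have "f differentiable at x" "g differentiable at x"
        using Suc.prems that \<open>open S\<close> by (metis Ck_on.simps(2) at_within_open differentiable_on_def)+
      then have "((\<lambda>x. f x + g x) has_derivative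
          (\<lambda>v. frechet_derivative f (at x) v + frechet_derivative g (at x) v)) (at x)"
        unfolding frechet_derivative_works by (rule has_derivative_add)
      from frechet_derivative_at[OF this] show ?thesis
        by metis
    qed
  qed
  moreover have "(\<lambda>x. f x + g x) differentiable_on S"
    using Suc.prems by (simp add: differentiable_on_def)
  ultimately show ?case
    by simp
qed

lemma Ck_on_mult:
  fixes f g :: "'v::euclidean_space \<Rightarrow> real"
  assumes "open S" "Ck_on k S f" "Ck_on k S g"
  shows "Ck_on k S (\<lambda>x. f x * g x)"
  using assms(2,3)
proof (induction k arbitrary: f g)
  case 0
  then show ?case by (auto intro: continuous_intros)
next
  case (Suc k)
  have "Ck_on k S (\<lambda>x. frechet_derivative (\<lambda>x. f x * g x) (at x) v)" for v
  proof (rule Ck_on_cong[OF \<open>open S\<close>])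
    show "Ck_on k S (\<lambda>x. f x * frechet_derivative g (at x) v + frechet_derivative f (at x) v * g x)"
      using Suc.prems Ck_on_Suc_imp[OF Suc.prems(1)] Ck_on_Suc_imp[OF Suc.prems(2)]
      by (intro Ck_on_add[OF \<open>open S\<close>] Suc.IH) simp_all
    show "f x * frechet_derivative g (at x) v + frechet_derivative f (at x) v * g x =
      frechet_derivative (\<lambda>x. f x * g x) (at x) v" if "x \<in> S" for x
    proof -
      have "f differentiable at x" "g differentiable at x"
        using Suc.prems that \<open>open S\<close> by (metis Ck_on.simps(2) at_within_open differentiable_on_def)+
      then have "((\<lambda>x. f x * g x) has_derivative
          (\<lambda>v. f x * frechet_derivative g (at x) v + frechet_derivative f (at x) v * g x)) (at x)"
        unfolding frechet_derivative_works by (rule has_derivative_mult)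
      from frechet_derivative_at[OF this] show ?thesis
        by metis
    qed
  qed
  moreover have "(\<lambda>x. f x * g x) differentiable_on S"
    using Suc.prems by (simp add: differentiable_on_def)
  ultimately show ?case
    by simp
qed

definition function_algebra :: "('a \<Rightarrow> real) set \<Rightarrow> bool" where
  "function_algebra F \<longleftrightarrow> (\<forall>c. (\<lambda>p. c) \<in> F) \<and> (\<forall>f\<in>F. \<forall>g\<in>F. f + g \<in> F \<and> f * g \<in> F)"

lemma function_algebra_smooth:
  assumes "smooth_atlas A"
  shows "function_algebra (smooth_functions A)"
proof -
  have "open (x ` U)" if "(U, x) \<in> A" for U x
    using assms that unfolding smooth_atlas_def by blast
  then show ?thesis
    unfolding function_algebra_def smooth_functions_def smooth_on_def
    by (fastforce simp: comp_def intro: Ck_on_const Ck_on_add Ck_on_mult)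
qed

lemma function_algebra_zero: "function_algebra F \<Longrightarrow> 0 \<in> F"
  by (simp add: function_algebra_def zero_fun_def)

lemma function_algebra_minus_one: "function_algebra F \<Longrightarrow> - 1 \<in> F"
  unfolding function_algebra_def by (simp add: fun_Compl_def one_fun_def)

section \<open>Linear maps over an algebra of functions\<close>

lemma fscale_add: "f \<odot> (x + y) = f \<odot> x + f \<odot> y"
  by (auto simp: fscale_def fun_eq_iff algebra_simps)

lemma fscale_diff: "f \<odot> (x - y) = f \<odot> x - f \<odot> y"
  by (auto simp: fscale_def fun_eq_iff algebra_simps)

lemma fscale_minus: "f \<odot> (- x) = - (f \<odot> x)"
  by (auto simp: fscale_def fun_eq_iff)

lemma fscale_zero: "f \<odot> 0 = 0"
  by (auto simp: fscale_def fun_eq_iff)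

lemma zero_fscale: "0 \<odot> x = 0"
  by (auto simp: fscale_def fun_eq_iff)

lemma minus_one_fscale: "(- 1) \<odot> x = - x"
  by (auto simp: fscale_def fun_eq_iff)

text \<open>A vector field and a one-form are both functions into the scalar functions, with the same
  pointwise multiplication \<open>\<odot>\<close>; one notion of module, polymorphic in the argument type, therefore serves
  for the domains and codomains of \<open>\<phi>\<close>, \<open>\<phi>\<^sup>*\<close> and \<open>\<beta>\<close>.\<close>

definition fmodule :: "('a \<Rightarrow> real) set \<Rightarrow> ('b \<Rightarrow> 'a \<Rightarrow> real) set \<Rightarrow> bool" where
  "fmodule F M \<longleftrightarrow> function_algebra F \<and>
     0 \<in> M \<and> (\<forall>x\<in>M. \<forall>y\<in>M. x + y \<in> M) \<and> (\<forall>f\<in>F. \<forall>x\<in>M. f \<odot> x \<in> M)"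

lemma fmodule_add: "fmodule F M \<Longrightarrow> x \<in> M \<Longrightarrow> y \<in> M \<Longrightarrow> x + y \<in> M"
  by (simp add: fmodule_def)

lemma fmodule_minus: "fmodule F M \<Longrightarrow> x \<in> M \<Longrightarrow> - x \<in> M"
  unfolding fmodule_def by (metis function_algebra_minus_one minus_one_fscale)

lemma fmodule_diff: "fmodule F M \<Longrightarrow> x \<in> M \<Longrightarrow> y \<in> M \<Longrightarrow> x - y \<in> M"
  using fmodule_add[of F M x "- y"] fmodule_minus[of F M y] by simp

definition fmodule_hom :: "('a \<Rightarrow> real) set \<Rightarrow> ('b \<Rightarrow> 'a \<Rightarrow> real) set \<Rightarrow> ('c \<Rightarrow> 'a \<Rightarrow> real) set \<Rightarrow>
    (('b \<Rightarrow> 'a \<Rightarrow> real) \<Rightarrow> ('c \<Rightarrow> 'a \<Rightarrow> real)) \<Rightarrow> bool" where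
  "fmodule_hom F M N h \<longleftrightarrow> fmodule F M \<and> fmodule F N \<and> (\<forall>x\<in>M. h x \<in> N) \<and>
     (\<forall>x\<in>M. \<forall>y\<in>M. h (x + y) = h x + h y) \<and> (\<forall>f\<in>F. \<forall>x\<in>M. h (f \<odot> x) = f \<odot> h x)"

lemma fmodule_hom_in: "fmodule_hom F M N h \<Longrightarrow> x \<in> M \<Longrightarrow> h x \<in> N"
  by (simp add: fmodule_hom_def)

lemma fmodule_hom_add: "fmodule_hom F M N h \<Longrightarrow> x \<in> M \<Longrightarrow> y \<in> M \<Longrightarrow> h (x + y) = h x + h y"
  by (simp add: fmodule_hom_def)

lemma fmodule_hom_fscale: "fmodule_hom F M N h \<Longrightarrow> f \<in> F \<Longrightarrow> x \<in> M \<Longrightarrow> h (f \<odot> x) = f \<odot> h x"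
  by (simp add: fmodule_hom_def)

lemma fmodule_hom_minus: "fmodule_hom F M N h \<Longrightarrow> x \<in> M \<Longrightarrow> h (- x) = - h x"
  unfolding fmodule_hom_def fmodule_def by (metis function_algebra_minus_one minus_one_fscale)

lemma fmodule_hom_diff:
  "fmodule_hom F M N h \<Longrightarrow> x \<in> M \<Longrightarrow> y \<in> M \<Longrightarrow> h (x - y) = h x - h y"
  using fmodule_hom_add[of F M N h x "- y"] fmodule_hom_minus[of F M N h y]
    fmodule_minus[of F M y] by (simp add: fmodule_hom_def)

lemma fmodule_hom_zero: "fmodule_hom F M N h \<Longrightarrow> h 0 = 0"
  unfolding fmodule_hom_def fmodule_def by (metis function_algebra_zero zero_fscale)

section \<open>Vector fields, one-forms and duals\<close>

lemma fmodule_vector_fields: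
  assumes "smooth_atlas A"
  shows "fmodule (smooth_functions A) (vector_fields A)"
proof -
  have alg: "function_algebra (smooth_functions A)"
    using assms by (rule function_algebra_smooth)
  have "X + Y \<in> vector_fields A" if "X \<in> vector_fields A" "Y \<in> vector_fields A" for X Y
    using that alg unfolding vector_fields_def function_algebra_def
    by (auto simp: fun_eq_iff algebra_simps)
  moreover have "f \<odot> X \<in> vector_fields A" if "f \<in> smooth_functions A" "X \<in> vector_fields A" for f X
    using that alg unfolding vector_fields_def function_algebra_def fscale_def
    by (auto simp: fun_eq_iff algebra_simps)
  moreover have "0 \<in> vector_fields A"
    using function_algebra_zero[OF alg] unfolding vector_fields_def by (auto simp: fun_eq_iff)
  ultimately show ?thesis
    using alg by (simp add: fmodule_def)
qed

lemma fmodule_one_forms: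
  assumes "smooth_atlas A"
  shows "fmodule (smooth_functions A) (one_forms A)"
proof -
  have alg: "function_algebra (smooth_functions A)"
    using assms by (rule function_algebra_smooth)
  have "\<alpha> + \<gamma> \<in> one_forms A" if "\<alpha> \<in> one_forms A" "\<gamma> \<in> one_forms A" for \<alpha> \<gamma>
    using that alg unfolding one_forms_def function_algebra_def by (auto simp: algebra_simps)
  moreover have "f \<odot> \<alpha> \<in> one_forms A" if "f \<in> smooth_functions A" "\<alpha> \<in> one_forms A" for f \<alpha>
    using that alg unfolding one_forms_def function_algebra_def
    by (auto simp: fscale_def[of f \<alpha>] algebra_simps)
  moreover have "0 \<in> one_forms A"
    using function_algebra_zero[OF alg] unfolding one_forms_def by auto
  ultimately show ?thesis
    using alg by (simp add: fmodule_def)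
qed

lemma one_form_add:
  "\<alpha> \<in> one_forms A \<Longrightarrow> X \<in> vector_fields A \<Longrightarrow> Y \<in> vector_fields A \<Longrightarrow> \<alpha> (X + Y) = \<alpha> X + \<alpha> Y"
  by (simp add: one_forms_def)

lemma one_form_fscale:
  "\<alpha> \<in> one_forms A \<Longrightarrow> f \<in> smooth_functions A \<Longrightarrow> X \<in> vector_fields A \<Longrightarrow> \<alpha> (f \<odot> X) = f * \<alpha> X"
  by (simp add: one_forms_def)

lemma one_form_in_smooth_functions:
  "\<alpha> \<in> one_forms A \<Longrightarrow> X \<in> vector_fields A \<Longrightarrow> \<alpha> X \<in> smooth_functions A"
  by (simp add: one_forms_def)

lemma one_form_diff:
  assumes "smooth_atlas A" "\<alpha> \<in> one_forms A" "X \<in> vector_fields A" "Y \<in> vector_fields A"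
  shows "\<alpha> (X - Y) = \<alpha> X - \<alpha> Y"
proof -
  have "X - Y \<in> vector_fields A"
    using assms fmodule_vector_fields fmodule_diff by blast
  from one_form_add[OF assms(2) this assms(4)] show ?thesis
    by simp
qed

lemma one_form_eqI:
  assumes "\<alpha> \<in> one_forms A" "\<gamma> \<in> one_forms A" "\<And>X. X \<in> vector_fields A \<Longrightarrow> \<alpha> X = \<gamma> X"
  shows "\<alpha> = \<gamma>"
proof
  show "\<alpha> X = \<gamma> X" for X
    using assms by (cases "X \<in> vector_fields A") (auto simp: one_forms_def)
qed

definition differential ::
  "('a::{t2_space, second_countable_topology}, 'n::finite) chart set \<Rightarrow> ('a \<Rightarrow> real) \<Rightarrow> 'a form" where
  "differential A f = (\<lambda>X. if X \<in> vector_fields A then X f else 0)"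

lemma differential_in_one_forms:
  assumes "smooth_atlas A" "f \<in> smooth_functions A"
  shows "differential A f \<in> one_forms A"
proof -
  have "fmodule (smooth_functions A) (vector_fields A)"
    using assms(1) by (rule fmodule_vector_fields)
  moreover have "X f \<in> smooth_functions A" if "X \<in> vector_fields A" for X
    using that assms(2) by (simp add: vector_fields_def)
  ultimately show ?thesis
    by (simp add: one_forms_def differential_def fmodule_def) (simp add: vector_fields_def fscale_def)
qed

text \<open>A derivation is determined by its values on smooth functions, and these are the values of the
  exact one-forms on it.\<close>

lemma vector_field_eqI:
  assumes "smooth_atlas A" "X \<in> vector_fields A" "Y \<in> vector_fields A"
    and "\<And>\<gamma>. \<gamma> \<in> one_forms A \<Longrightarrow> \<gamma> X = \<gamma> Y"
  shows "X = Y"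
proof
  fix f
  show "X f = Y f"
  proof (cases "f \<in> smooth_functions A")
    case True
    from assms(4)[OF differential_in_one_forms[OF assms(1) True]] show ?thesis
      by (simp add: differential_def assms(2,3))
  next
    case False
    then show ?thesis
      using assms(2,3) by (simp add: vector_fields_def)
  qed
qed

text \<open>By the previous lemma it suffices to compare values of one-forms \<open>\<gamma>\<close>, where
  \<open>\<gamma> (\<beta> \<alpha>) = B \<alpha> \<gamma>\<close> is linear in \<open>\<alpha>\<close>.\<close>

lemma bivector_map_linear:
  assumes "smooth_atlas A" "bivector_field A B" "bivector_map A B \<beta>"
  shows "fmodule_hom (smooth_functions A) (one_forms A) (vector_fields A) \<beta>"
proof -
  note VF = fmodule_vector_fields[OF assms(1)] and OF = fmodule_one_forms[OF assms(1)]
  have val: "\<beta> \<alpha> \<in> vector_fields A" "\<And>\<gamma>. \<gamma> \<in> one_forms A \<Longrightarrow> \<gamma> (\<beta> \<alpha>) = B \<alpha> \<gamma>"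
    if "\<alpha> \<in> one_forms A" for \<alpha>
    using assms(3) that by (auto simp: bivector_map_def)
  have B_add: "B (\<alpha> + \<alpha>') \<gamma> = B \<alpha> \<gamma> + B \<alpha>' \<gamma>"
    if "\<alpha> \<in> one_forms A" "\<alpha>' \<in> one_forms A" "\<gamma> \<in> one_forms A" for \<alpha> \<alpha>' \<gamma>
    using assms(2) that unfolding bivector_field_def by blast
  have B_fscale: "B (f \<odot> \<alpha>) \<gamma> = f * B \<alpha> \<gamma>"
    if "f \<in> smooth_functions A" "\<alpha> \<in> one_forms A" "\<gamma> \<in> one_forms A" for f \<alpha> \<gamma>
    using assms(2) that unfolding bivector_field_def by blast
  have "\<beta> (\<alpha> + \<alpha>') = \<beta> \<alpha> + \<beta> \<alpha>'" if "\<alpha> \<in> one_forms A" "\<alpha>' \<in> one_forms A" for \<alpha> \<alpha>'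
  proof (rule vector_field_eqI[OF assms(1)])
    have sum: "\<alpha> + \<alpha>' \<in> one_forms A"
      using OF that by (rule fmodule_add)
    show "\<beta> (\<alpha> + \<alpha>') \<in> vector_fields A"
      using val(1)[OF sum] .
    show "\<beta> \<alpha> + \<beta> \<alpha>' \<in> vector_fields A"
      using VF val(1) that by (blast intro: fmodule_add)
    show "\<gamma> (\<beta> (\<alpha> + \<alpha>')) = \<gamma> (\<beta> \<alpha> + \<beta> \<alpha>')" if g: "\<gamma> \<in> one_forms A" for \<gamma>
      using g \<open>\<alpha> \<in> _\<close> \<open>\<alpha>' \<in> _\<close>
      by (simp add: val sum one_form_add[OF g] B_add fun_eq_iff)
  qed
  moreover have "\<beta> (f \<odot> \<alpha>) = f \<odot> \<beta> \<alpha>" if "f \<in> smooth_functions A" "\<alpha> \<in> one_forms A" for f \<alpha>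
  proof (rule vector_field_eqI[OF assms(1)])
    have mult: "f \<odot> \<alpha> \<in> one_forms A"
      using OF that by (simp add: fmodule_def)
    show "\<beta> (f \<odot> \<alpha>) \<in> vector_fields A"
      using val(1)[OF mult] .
    show "f \<odot> \<beta> \<alpha> \<in> vector_fields A"
      using VF val(1) that by (simp add: fmodule_def)
    show "\<gamma> (\<beta> (f \<odot> \<alpha>)) = \<gamma> (f \<odot> \<beta> \<alpha>)" if g: "\<gamma> \<in> one_forms A" for \<gamma>
      using g \<open>f \<in> _\<close> \<open>\<alpha> \<in> _\<close>
      by (simp add: val mult one_form_fscale[OF g] B_fscale fun_eq_iff)
  qed
  ultimately show ?thesis
    using VF OF val(1) by (simp add: fmodule_hom_def)
qed

lemma tangent_endomorphism_linear:
  assumes "smooth_atlas A" "tangent_endomorphism A \<phi>"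
  shows "fmodule_hom (smooth_functions A) (vector_fields A) (vector_fields A) \<phi>"
  using assms by (simp add: fmodule_hom_def tangent_endomorphism_def fmodule_vector_fields)

lemma dual_linear:
  assumes "smooth_atlas A" "tangent_endomorphism A \<phi>"
  shows "fmodule_hom (smooth_functions A) (one_forms A) (one_forms A) (dual A \<phi>)"
proof -
  have VF: "fmodule (smooth_functions A) (vector_fields A)"
    using assms(1) by (rule fmodule_vector_fields)
  have "dual A \<phi> \<alpha> \<in> one_forms A" if "\<alpha> \<in> one_forms A" for \<alpha>
    using that assms(2) VF
    by (simp add: one_forms_def dual_def tangent_endomorphism_def fmodule_def)
  moreover have "dual A \<phi> (\<alpha> + \<gamma>) = dual A \<phi> \<alpha> + dual A \<phi> \<gamma>" for \<alpha> \<gamma>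
    by (auto simp: dual_def fun_eq_iff)
  moreover have "dual A \<phi> (f \<odot> \<alpha>) = f \<odot> dual A \<phi> \<alpha>" for f \<alpha>
    by (auto simp: dual_def fun_eq_iff fscale_def)
  ultimately show ?thesis
    using fmodule_one_forms[OF assms(1)] by (simp add: fmodule_hom_def)
qed

lemma dual_tensor:
  assumes "\<xi> \<in> vector_fields A" "\<eta> \<in> one_forms A" "\<alpha> \<in> one_forms A"
  shows "dual A (\<eta> \<otimes>\<^sub>t \<xi>) \<alpha> = \<alpha> \<xi> \<odot> \<eta>"
proof
  fix X
  show "dual A (\<eta> \<otimes>\<^sub>t \<xi>) \<alpha> X = (\<alpha> \<xi> \<odot> \<eta>) X"
  proof (cases "X \<in> vector_fields A")
    case True
    then have "\<alpha> (\<eta> X \<odot> \<xi>) = \<eta> X * \<alpha> \<xi>"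
      using assms by (intro one_form_fscale) (simp_all add: one_forms_def)
    then show ?thesis
      using True by (simp add: dual_def tensor_def fscale_def[of "\<alpha> \<xi>"] mult.commute)
  next
    case False
    then show ?thesis
      using assms(2) by (simp add: dual_def fscale_def one_forms_def)
  qed
qed

section \<open>Conjugation by the exponential of a bivector field\<close>

lemma conjugated_endomorphism:
  assumes "fmodule_hom F V V \<phi>" "fmodule_hom F W V \<beta>" "fmodule_hom F W W (dual A \<phi>)"
    and "X \<in> V" "\<alpha> \<in> W"
  shows "(exp_bivector \<beta> \<circ> induced_endomorphism A \<phi> \<circ> exp_bivector (- \<beta>)) (X, \<alpha>) =
    (\<phi> X - \<phi> (\<beta> \<alpha>) - \<beta> (dual A \<phi> \<alpha>), - dual A \<phi> \<alpha>)"
  using fmodule_hom_diff[OF assms(1,4) fmodule_hom_in[OF assms(2,5)]]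
    fmodule_hom_minus[OF assms(2) fmodule_hom_in[OF assms(3,5)]]
  by (simp add: exp_bivector_def induced_endomorphism_def block_def)

theorem proposition3p3:
  fixes A :: "('a::{t2_space, second_countable_topology}, 'n::finite) chart set"
    and \<phi> :: "'a vfield \<Rightarrow> 'a vfield" and \<xi> :: "'a vfield" and \<eta> :: "'a form"
    and B :: "'a form \<Rightarrow> 'a form \<Rightarrow> 'a \<Rightarrow> real" and \<beta> :: "'a form \<Rightarrow> 'a vfield"
  assumes "smooth_atlas A" and "odd CARD('n)"
    and "almost_paracontact A \<phi> \<xi> \<eta>"
    and "bivector_field A B" and "bivector_map A B \<beta>"
    and "\<forall>\<alpha>\<in>one_forms A. \<eta> (\<beta> \<alpha>) \<odot> \<xi> = \<alpha> \<xi> \<odot> \<beta> \<eta>"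
  shows "generalized_almost_paracontact A
           (exp_bivector \<beta> \<circ> induced_endomorphism A \<phi> \<circ> exp_bivector (- \<beta>)) \<xi> \<eta>"
proof -
  let ?F = "smooth_functions A" and ?V = "vector_fields A" and ?W = "one_forms A"
  let ?\<Phi> = "exp_bivector \<beta> \<circ> induced_endomorphism A \<phi> \<circ> exp_bivector (- \<beta>)"
  define \<psi> where "\<psi> = dual A \<phi>"
  have sq: "\<phi> (\<phi> X) = X - \<eta> X \<odot> \<xi>" and \<eta>\<phi>: "\<eta> (\<phi> X) = 0" if "X \<in> ?V" for X
    using assms(3) that unfolding almost_paracontact_def by (simp_all add: tensor_def)
  have \<eta>\<xi>: "\<eta> \<xi> = 1" and \<phi>\<xi>: "\<phi> \<xi> = 0" and tan: "tangent_endomorphism A \<phi>"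
    and \<xi>: "\<xi> \<in> ?V" and \<eta>: "\<eta> \<in> ?W"
    using assms(3) unfolding almost_paracontact_def by simp_all
  have \<phi>: "fmodule_hom ?F ?V ?V \<phi>"
    using assms(1) tan by (rule tangent_endomorphism_linear)
  have \<beta>: "fmodule_hom ?F ?W ?V \<beta>"
    using assms(1,4,5) by (rule bivector_map_linear)
  have \<psi>: "fmodule_hom ?F ?W ?W \<psi>"
    unfolding \<psi>_def using assms(1) tan by (rule dual_linear)
  have V: "fmodule ?F ?V" and W: "fmodule ?F ?W"
    using \<beta> by (simp_all add: fmodule_hom_def)
  note mem = fmodule_hom_in[OF \<phi>] fmodule_hom_in[OF \<beta>] fmodule_hom_in[OF \<psi>]
    fmodule_add[OF V] fmodule_add[OF W] fmodule_minus[OF V] fmodule_minus[OF W]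
    fmodule_diff[OF V] fmodule_diff[OF W] one_form_in_smooth_functions \<xi> \<eta>
  have memV: "f \<odot> X \<in> ?V" if "f \<in> ?F" "X \<in> ?V" for f X
    using V that by (simp add: fmodule_def)
  have memW: "f \<odot> \<alpha> \<in> ?W" if "f \<in> ?F" "\<alpha> \<in> ?W" for f \<alpha>
    using W that by (simp add: fmodule_def)
  note mem = mem memV memW
  note lin = fmodule_hom_add[OF \<phi>] fmodule_hom_add[OF \<beta>] fmodule_hom_add[OF \<psi>]
    fmodule_hom_diff[OF \<phi>] fmodule_hom_diff[OF \<beta>] fmodule_hom_diff[OF \<psi>]
    fmodule_hom_minus[OF \<phi>] fmodule_hom_minus[OF \<beta>] fmodule_hom_minus[OF \<psi>]
    fmodule_hom_fscale[OF \<phi>] fmodule_hom_fscale[OF \<beta>] fmodule_hom_fscale[OF \<psi>]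
    fmodule_hom_zero[OF \<phi>] fmodule_hom_zero[OF \<beta>] fmodule_hom_zero[OF \<psi>]
  have \<Phi>: "?\<Phi> (X, \<alpha>) = (\<phi> X - \<phi> (\<beta> \<alpha>) - \<beta> (\<psi> \<alpha>), - \<psi> \<alpha>)" if "X \<in> ?V" "\<alpha> \<in> ?W" for X \<alpha>
    using conjugated_endomorphism[OF \<phi> \<beta> \<psi>[unfolded \<psi>_def] that] by (simp add: \<psi>_def)
  have B: "\<gamma> (\<beta> \<alpha>) = B \<alpha> \<gamma>" if "\<alpha> \<in> ?W" "\<gamma> \<in> ?W" for \<alpha> \<gamma>
    using assms(5) that by (simp add: bivector_map_def)
  have skew: "B \<alpha> \<gamma> = - B \<gamma> \<alpha>" if "\<alpha> \<in> ?W" "\<gamma> \<in> ?W" for \<alpha> \<gamma>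
    using assms(4) that unfolding bivector_field_def by blast
  have \<psi>_apply: "\<psi> \<alpha> X = \<alpha> (\<phi> X)" if "X \<in> ?V" for \<alpha> X
    using that by (simp add: \<psi>_def dual_def)
  have hyp: "\<eta> (\<beta> \<alpha>) \<odot> \<xi> = \<alpha> \<xi> \<odot> \<beta> \<eta>" if "\<alpha> \<in> ?W" for \<alpha>
    using assms(6) that by blast
  have \<psi>\<eta>: "\<psi> \<eta> = 0"
    by (auto simp: \<psi>_def dual_def \<eta>\<phi> fun_eq_iff)
  have \<psi>_sq: "\<psi> (\<psi> \<alpha>) = \<alpha> - \<alpha> \<xi> \<odot> \<eta>" if \<alpha>: "\<alpha> \<in> ?W" for \<alpha>
  proof (rule one_form_eqI)
    show "\<psi> (\<psi> \<alpha>) \<in> ?W" "\<alpha> - \<alpha> \<xi> \<odot> \<eta> \<in> ?W"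
      using \<alpha> by (simp_all add: mem)
    show "\<psi> (\<psi> \<alpha>) X = (\<alpha> - \<alpha> \<xi> \<odot> \<eta>) X" if "X \<in> ?V" for X
      using \<alpha> that
      by (simp add: \<psi>_apply mem sq one_form_diff[OF assms(1)] one_form_fscale
          fscale_def[of _ \<eta>] fun_eq_iff)
  qed
  have dual_proj: "dual A (id - \<eta> \<otimes>\<^sub>t \<xi>) \<alpha> = \<alpha> - \<alpha> \<xi> \<odot> \<eta>" if \<alpha>: "\<alpha> \<in> ?W" for \<alpha>
  proof -
    have "dual A (id - \<eta> \<otimes>\<^sub>t \<xi>) \<alpha> = \<psi> (\<psi> \<alpha>)"
      by (auto simp: fun_eq_iff dual_def \<psi>_def sq tensor_def mem)
    then show ?thesis
      using \<psi>_sq[OF \<alpha>] by simp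
  qed
  have "gen_endomorphism A ?\<Phi>"
    unfolding gen_endomorphism_def gsections_def
    by (auto simp del: comp_apply simp: \<Phi> mem lin fscale_add fscale_diff fscale_minus algebra_simps)
  moreover have "g0 (?\<Phi> s) t = - g0 s (?\<Phi> t)" if sec: "s \<in> gsections A" "t \<in> gsections A" for s t
  proof -
    obtain X \<alpha> Y \<gamma> where st: "s = (X, \<alpha>)" "t = (Y, \<gamma>)"
      and m: "X \<in> ?V" "\<alpha> \<in> ?W" "Y \<in> ?V" "\<gamma> \<in> ?W"
      using sec unfolding gsections_def by blast
    have corner: "\<gamma> (\<phi> X - \<phi> (\<beta> \<alpha>) - \<beta> (\<psi> \<alpha>)) = \<gamma> (\<phi> X) - B \<alpha> (\<psi> \<gamma>) - B (\<psi> \<alpha>) \<gamma>"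
      if "X \<in> ?V" "\<alpha> \<in> ?W" "\<gamma> \<in> ?W" for X \<alpha> \<gamma>
    proof -
      have "\<gamma> (\<phi> (\<beta> \<alpha>)) = B \<alpha> (\<psi> \<gamma>)"
        using that by (simp add: B[symmetric] \<psi>_apply mem)
      then show ?thesis
        using that by (simp add: mem one_form_diff[OF assms(1)] B fun_eq_iff)
    qed
    show ?thesis
      using m skew[of \<alpha> "\<psi> \<gamma>"] skew[of "\<psi> \<alpha>" \<gamma>]
      by (simp del: comp_apply
          add: st \<Phi> g0_def corner mem \<psi>_apply) (simp add: fun_eq_iff field_simps)
  qed
  moreover have "?\<Phi> (?\<Phi> s) = block (id - \<eta> \<otimes>\<^sub>t \<xi>) 0 0 (dual A (id - \<eta> \<otimes>\<^sub>t \<xi>)) s"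
    if sec: "s \<in> gsections A" for s
  proof -
    obtain X \<alpha> where s: "s = (X, \<alpha>)" and m: "X \<in> ?V" "\<alpha> \<in> ?W"
      using sec unfolding gsections_def by blast
    have "?\<Phi> (?\<Phi> s) = (\<phi> (\<phi> X) - \<phi> (\<phi> (\<beta> \<alpha>)) + \<beta> (\<psi> (\<psi> \<alpha>)), \<psi> (\<psi> \<alpha>))"
      using m by (simp del: comp_apply add: s \<Phi> mem lin)
    \<comment> \<open>Here \<open>\<beta> (\<alpha> - \<alpha> \<xi> \<odot> \<eta>)\<close> cancels \<open>\<beta> \<alpha> - \<eta> (\<beta> \<alpha>) \<odot> \<xi>\<close>, by the hypothesis on \<open>\<beta>\<close>.\<close>
    also have "\<dots> = (X - \<eta> X \<odot> \<xi>, \<alpha> - \<alpha> \<xi> \<odot> \<eta>)"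
      using m hyp[of \<alpha>] by (simp add: sq \<psi>_sq mem lin)
    also have "\<dots> = block (id - \<eta> \<otimes>\<^sub>t \<xi>) 0 0 (dual A (id - \<eta> \<otimes>\<^sub>t \<xi>)) s"
      using m by (simp add: s block_def dual_proj tensor_def)
    finally show ?thesis .
  qed
  moreover have "?\<Phi> (block (\<eta> \<otimes>\<^sub>t \<xi>) 0 0 (dual A (\<eta> \<otimes>\<^sub>t \<xi>)) s) = 0" if sec: "s \<in> gsections A" for s
  proof -
    obtain X \<alpha> where s: "s = (X, \<alpha>)" and m: "X \<in> ?V" "\<alpha> \<in> ?W"
      using sec unfolding gsections_def by blast
    have "block (\<eta> \<otimes>\<^sub>t \<xi>) 0 0 (dual A (\<eta> \<otimes>\<^sub>t \<xi>)) s = (\<eta> X \<odot> \<xi>, \<alpha> \<xi> \<odot> \<eta>)"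
      using m by (simp add: s block_def dual_tensor \<xi> \<eta> tensor_def)
    moreover have "\<phi> (\<beta> (\<alpha> \<xi> \<odot> \<eta>)) = 0"
    proof -
      have "\<phi> (\<beta> (\<alpha> \<xi> \<odot> \<eta>)) = \<phi> (\<eta> (\<beta> \<alpha>) \<odot> \<xi>)"
        using m by (simp add: lin mem hyp)
      also have "\<dots> = 0"
        using m by (simp add: lin mem \<phi>\<xi> fscale_zero)
      finally show ?thesis .
    qed
    ultimately show ?thesis
      using m by (simp del: comp_apply
          add: \<Phi> mem fmodule_hom_fscale[OF \<phi>] fmodule_hom_fscale[OF \<psi>] \<phi>\<xi> \<psi>\<eta> fscale_zero
          fmodule_hom_zero[OF \<beta>] zero_prod_def)
  qed
  moreover have "g0 (\<xi>, \<eta>) (\<xi>, \<eta>) = 1"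
    by (simp add: g0_def \<eta>\<xi> fun_eq_iff)
  ultimately show ?thesis
    using \<xi> \<eta> by (simp add: generalized_almost_paracontact_def del: comp_apply)
qed

end
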